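(* Let $n\ge 1$ and let $e_1\ge e_2\ge\dots\ge e_n\ge 0$ be integers, and set $s_i=\sum_{j=1}^i e_j$. There exists a simple graph $G$ with a vertex $P\in V(G)$ such that \[H_r(P)=\{0,s_1,s_2,\dots,s_{n-1}\}\cup(s_n+\mathbb{N}).\]
   Context: A graph is a finite connected multigraph with no loop edges; a simple graph is a graph with no multiple edges and more than one vertex. $\mathbb{N}=\{0,1,2,\dots\}$. A divisor on $G$ is a formal integer combination $D=\sum_{Q\in V(G)} D(Q)\,Q$; $\deg D=\sum_Q D(Q)$; $D$ is effective if all coefficients are $\ge 0$. For $f:V(G)\to\mathbb{Z}$, $\Delta f$ is the divisor with $\Delta f(Q)=\sum_{e=QR\in E(G)}(f(Q)-f(R))$ (edges counted with multiplicity). $|D|=\{E\ge 0: E-D=\Delta f\text{ for some }f\}$. The rank $r(D)$ is $-1$ if $|D|=\emptyset$, and otherwise the largest $k\in\mathbb{N}$ such that $|D-E|\neq\emptyset$ for every effective divisor $E$ of degree $k$. For $P\in V(G)$, $H_r(P)=\{n\in\mathbb{N}: r(nP)>r((n-1)P)\}$, and $s+\mathbb{N}=\{s+m:m\in\mathbb{N}\}$. *)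

theory Defs
  imports
    "Graph_Theory.Digraph_Component"
    "Graph_Theory.Bidirected_Digraph"
begin

text \<open>
  An undirected edge between \<open>Q\<close> and \<open>R\<close> is encoded, as usual in \<^theory>\<open>Graph_Theory.Digraph\<close>,
  by a pair of opposite arcs. Parallel edges are distinct pairs of arcs, and the arc reversal
  demanded by \<^locale>\<open>bidirected_digraph\<close> ensures that there are as many arcs from \<open>Q\<close> to \<open>R\<close> as
  from \<open>R\<close> to \<open>Q\<close>. The predicate \<^const>\<open>connected\<close> excludes the graph without vertices.
\<close>

definition multigraph :: "('a, 'b) pre_digraph \<Rightarrow> bool" where
  "multigraph G \<longleftrightarrow>
     fin_digraph G \<and> loopfree_digraph G \<and> (\<exists>rev. bidirected_digraph G rev) \<and> connected G"

definition simple_graph :: "('a, 'b) pre_digraph \<Rightarrow> bool" where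
  "simple_graph G \<longleftrightarrow> multigraph G \<and> nomulti_digraph G \<and> card (verts G) > 1"

lemma simple_graph_iff_graph:
  "simple_graph G \<longleftrightarrow> graph G \<and> connected G \<and> card (verts G) > 1"
proof
  assume "simple_graph G"
  then obtain rev where G: "fin_digraph G" "loopfree_digraph G" "nomulti_digraph G"
      "bidirected_digraph G rev" and conn: "connected G" "card (verts G) > 1"
    by (auto simp: simple_graph_def multigraph_def)
  interpret bidirected_digraph G rev by fact
  have "graph G"
    unfolding graph_def digraph_def pseudo_graph_def
    using G by (auto intro: sym_digraph_axioms)
  with conn show "graph G \<and> connected G \<and> card (verts G) > 1" by simp
next
  assume G: "graph G \<and> connected G \<and> card (verts G) > 1"
  interpret graph G using G by simp
  define rev where "rev a = (if a \<in> arcs G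
    then SOME b. b \<in> arcs G \<and> tail G b = head G a \<and> head G b = tail G a else a)" for a
  have rev: "rev a \<in> arcs G \<and> tail G (rev a) = head G a \<and> head G (rev a) = tail G a"
    if "a \<in> arcs G" for a
  proof -
    have "\<exists>b. b \<in> arcs G \<and> tail G b = head G a \<and> head G b = tail G a"
      using sym_arcs that unfolding symmetric_conv by metis
    from someI_ex[OF this] that show ?thesis by (simp add: rev_def)
  qed
  have "bidirected_digraph G rev"
  proof (rule bidirected_digraphI)
    show "rev a = a" if "a \<notin> arcs G" for a using that by (simp add: rev_def)
    show "rev a \<noteq> a" if "a \<in> arcs G" for a using rev[OF that] no_loops[OF that] by metis
    show "rev (rev a) = a" if "a \<in> arcs G" for a
      using rev[OF that] rev[of "rev a"] that
      by (intro no_multi_arcs) (auto simp: arc_to_ends_def)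
    show "tail G (rev a) = head G a" if "a \<in> arcs G" for a using rev[OF that] by simp
  qed
  then show "simple_graph G"
    unfolding simple_graph_def multigraph_def
    using G fin_digraph_axioms loopfree_digraph_axioms nomulti_digraph_axioms by auto
qed

text \<open>Divisors are integer-valued functions on the vertex type that vanish outside the graph.\<close>

definition divisor_on :: "('a, 'b) pre_digraph \<Rightarrow> ('a \<Rightarrow> int) \<Rightarrow> bool" where
  "divisor_on G D \<longleftrightarrow> (\<forall>Q. Q \<notin> verts G \<longrightarrow> D Q = 0)"

definition effective_on :: "('a, 'b) pre_digraph \<Rightarrow> ('a \<Rightarrow> int) \<Rightarrow> bool" where
  "effective_on G D \<longleftrightarrow> divisor_on G D \<and> (\<forall>Q\<in>verts G. D Q \<ge> 0)"

definition divisor_degree :: "('a, 'b) pre_digraph \<Rightarrow> ('a \<Rightarrow> int) \<Rightarrow> int" where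
  "divisor_degree G D = (\<Sum>Q\<in>verts G. D Q)"

text \<open>
  Each edge at \<open>Q\<close> contributes exactly one arc with tail \<open>Q\<close>, so the sum below runs over the
  edges at \<open>Q\<close> with multiplicity. It is empty for \<open>Q\<close> outside the graph, and the values of \<open>f\<close>
  there do not matter.
\<close>

definition laplacian :: "('a, 'b) pre_digraph \<Rightarrow> ('a \<Rightarrow> int) \<Rightarrow> 'a \<Rightarrow> int" where
  "laplacian G f Q = (\<Sum>a\<in>out_arcs G Q. f Q - f (head G a))"

definition linear_system :: "('a, 'b) pre_digraph \<Rightarrow> ('a \<Rightarrow> int) \<Rightarrow> ('a \<Rightarrow> int) set" where
  "linear_system G D = {E. effective_on G E \<and> (\<exists>f. (\<lambda>Q. E Q - D Q) = laplacian G f)}"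

definition divisor_rank :: "('a, 'b) pre_digraph \<Rightarrow> ('a \<Rightarrow> int) \<Rightarrow> int" where
  "divisor_rank G D =
     (if linear_system G D = {} then - 1
      else int (GREATEST k::nat. \<forall>E. effective_on G E \<and> divisor_degree G E = int k \<longrightarrow>
                  linear_system G (\<lambda>Q. D Q - E Q) \<noteq> {}))"

definition point_multiple :: "int \<Rightarrow> 'a \<Rightarrow> 'a \<Rightarrow> int" where
  "point_multiple n P = (\<lambda>Q. if Q = P then n else 0)"

text \<open>The integer subtraction matters at \<open>n = 0\<close>, where the divisor \<open>- P\<close> has rank \<open>- 1\<close>.\<close>

definition rank_jump_set :: "('a, 'b) pre_digraph \<Rightarrow> 'a \<Rightarrow> nat set" where
  "rank_jump_set G P =
     {n. divisor_rank G (point_multiple (int n) P) > divisor_rank G (point_multiple (int n - 1) P)}"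

end

theory Submission
  imports Defs "HOL-Library.Nat_Bijection"
begin

text \<open>
  Suppose all \<open>e\<^sub>i\<close> are positive. Let \<open>G\<close> be the wedge at \<open>P\<close> of \<open>n\<close> bananas, the \<open>i\<close>-th
  consisting of a vertex \<open>v\<^sub>i\<close> joined to \<open>P\<close> by \<open>e\<^sub>i\<close> paths of length two (so the graph is simple).
  Since \<open>P\<close> is a cut vertex, the number of chips needed at \<open>P\<close> to dominate an effective divisor \<open>E\<close>
  is the sum of the costs of the bananas. A banana carrying \<open>d > 0\<close> chips of \<open>E\<close> costs at most
  \<open>d + e\<^sub>i - 1\<close> (its genus is \<open>e\<^sub>i - 1\<close>), with equality for the single chip \<open>v\<^sub>i\<close>. As the \<open>e\<^sub>i\<close>
  decrease, the most expensive \<open>E\<close> of degree \<open>j\<close> puts one chip on each of \<open>v\<^sub>1, \<dots>, v\<^sub>j\<close>, and for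
  \<open>j > n\<close> the \<open>j - n\<close> further chips cost one each. Hence \<open>r(kP) \<ge> j\<close> iff \<open>k \<ge> s\<^sub>j\<close>, or
  \<open>k \<ge> s\<^sub>n + (j - n)\<close> for \<open>j > n\<close>, and the jumps of the rank are these thresholds. Vanishing \<open>e\<^sub>i\<close>
  do not change the right-hand side and are dropped.
\<close>

section \<open>Rank thresholds on an arbitrary graph\<close>

text \<open>The function \<open>f\<close> determines the effective divisor as \<open>D\<close> plus
  the Laplacian of \<open>f\<close>. Outside the graph there are no outgoing arcs, so this sum is
  again supported on the vertices.\<close>

lemma linear_system_nonempty_iff:
  assumes "wf_digraph G" "divisor_on G D"
  shows "linear_system G D \<noteq> {} \<longleftrightarrow> (\<exists>f. \<forall>Q\<in>verts G. 0 \<le> D Q + laplacian G f Q)"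
proof
  assume "linear_system G D \<noteq> {}"
  then obtain E f where E: "effective_on G E" "(\<lambda>Q. E Q - D Q) = laplacian G f"
    unfolding linear_system_def by blast
  from fun_cong[OF E(2)] have "E Q = D Q + laplacian G f Q" for Q
    by (simp add: algebra_simps)
  with E(1) show "\<exists>f. \<forall>Q\<in>verts G. 0 \<le> D Q + laplacian G f Q"
    unfolding effective_on_def by metis
next
  interpret wf_digraph G by fact
  assume "\<exists>f. \<forall>Q\<in>verts G. 0 \<le> D Q + laplacian G f Q"
  then obtain f where f: "\<forall>Q\<in>verts G. 0 \<le> D Q + laplacian G f Q" by blast
  have "laplacian G f Q = 0" if "Q \<notin> verts G" for Q
  proof -
    have "out_arcs G Q = {}" using that tail_in_verts by (auto simp: out_arcs_def)
    then show ?thesis by (simp add: laplacian_def)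
  qed
  with f assms(2) have "(\<lambda>Q. D Q + laplacian G f Q) \<in> linear_system G D"
    unfolding linear_system_def effective_on_def divisor_on_def by auto
  then show "linear_system G D \<noteq> {}" by blast
qed

text \<open>The hypothesis makes \<open>m j\<close> the least \<open>k\<close> with r(kP) \<ge> j.
  So the rank passes from below \<open>j\<close> to at least \<open>j\<close> exactly at
  \<open>k = m j\<close>, and every jump is such a passage.\<close>

lemma rank_jump_set_eq_range:
  fixes m :: "nat \<Rightarrow> nat"
  assumes m: "strict_mono m" "m 0 = 0"
    and iff: "\<And>j k. (\<forall>E. effective_on G E \<and> divisor_degree G E = int j \<longrightarrow>
        linear_system G (\<lambda>Q. point_multiple k P Q - E Q) \<noteq> {}) \<longleftrightarrow> int (m j) \<le> k"
    and fin: "finite (verts G)"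
  shows "rank_jump_set G P = range m"
proof -
  define rk where "rk k = divisor_rank G (point_multiple k P)" for k
  have zero: "E = (\<lambda>Q. 0)" if "effective_on G E" "divisor_degree G E = 0" for E
  proof
    fix Q
    show "E Q = 0"
      using that fin sum_nonneg_eq_0_iff[of "verts G" E]
      by (cases "Q \<in> verts G") (auto simp: effective_on_def divisor_on_def divisor_degree_def)
  qed
  \<comment> \<open>This is the threshold for \<open>j = 0\<close>, since the zero divisor is the
    only effective divisor of degree 0.\<close>
  have nonempty: "linear_system G (point_multiple k P) \<noteq> {} \<longleftrightarrow> 0 \<le> k" for k
  proof -
    have "effective_on G (\<lambda>Q. 0)" "divisor_degree G (\<lambda>Q. 0) = 0"
      by (auto simp: effective_on_def divisor_on_def divisor_degree_def)
    then have "(\<forall>E. effective_on G E \<and> divisor_degree G E = int 0 \<longrightarrow>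
        linear_system G (\<lambda>Q. point_multiple k P Q - E Q) \<noteq> {}) \<longleftrightarrow>
        linear_system G (point_multiple k P) \<noteq> {}"
      using zero by fastforce
    then show ?thesis using iff[of 0 k] m(2) by simp
  qed
  have ge: "int j \<le> rk k \<longleftrightarrow> int (m j) \<le> k" for j k
  proof (cases "0 \<le> k")
    case False
    then show ?thesis using nonempty[of k] by (simp add: rk_def divisor_rank_def)
  next
    case True
    define g where "g = (GREATEST j. int (m j) \<le> k)"
    \<comment> \<open>A strictly increasing \<open>m\<close> satisfies \<open>j \<le> m j\<close>;
      hence the candidates are bounded and \<open>GREATEST\<close> is attained.\<close>
    have bound: "j \<le> nat k" if "int (m j) \<le> k" for j
      using that strict_mono_imp_increasing[OF m(1), of j] by linarith
    have g1: "int (m g) \<le> k"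
      unfolding g_def using GreatestI_nat[of "\<lambda>j. int (m j) \<le> k" 0 "nat k"] bound True m(2) by simp
    have g2: "j \<le> g" if "int (m j) \<le> k" for j
      unfolding g_def using Greatest_le_nat[of "\<lambda>j. int (m j) \<le> k" j "nat k"] bound that by simp
    have "rk k = int g"
      using nonempty[of k] True by (simp add: rk_def divisor_rank_def iff g_def)
    moreover have "int (m j) \<le> k" if "j \<le> g"
      using g1 strict_mono_mono[OF m(1)] that by (meson monoD of_nat_mono order_trans)
    ultimately show ?thesis using g2 by auto
  qed
  have "x \<in> rank_jump_set G P \<longleftrightarrow> x \<in> range m" for x
  proof
    assume "x \<in> rank_jump_set G P"
    then have lt: "rk (int x - 1) < rk (int x)" by (simp add: rank_jump_set_def rk_def)
    have "0 \<le> rk (int x)" using ge[of 0 "int x"] m(2) by simp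
    then obtain j where j: "rk (int x) = int j" using nonneg_int_cases by metis
    have "int (m j) \<le> int x" "\<not> int (m j) \<le> int x - 1"
      using ge[of j "int x"] ge[of j "int x - 1"] lt j by auto
    then show "x \<in> range m" by auto
  next
    assume "x \<in> range m"
    then obtain j where "x = m j" by auto
    then have "int j \<le> rk (int x)" "\<not> int j \<le> rk (int x - 1)" by (simp_all add: ge)
    then show "x \<in> rank_jump_set G P" by (simp add: rank_jump_set_def rk_def)
  qed
  then show ?thesis by blast
qed

section \<open>The wedge of bananas as a simple graph\<close>

text \<open>The successor keeps the value 0 free for the wedge point P.\<close>

definition node :: "nat \<Rightarrow> nat \<Rightarrow> nat" where
  "node i k = Suc (prod_encode (i, k))"

lemma node_eq_iff [simp]: "node i k = node i' k' \<longleftrightarrow> i = i' \<and> k = k'"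
  by (simp add: node_def)

lemma node_neq_0 [simp]: "node i k \<noteq> 0" "0 \<noteq> node i k"
  by (simp_all add: node_def)

text \<open>
  The \<open>i\<close>-th banana joins \<open>0\<close> to \<open>node i 0\<close> by \<open>e i\<close> paths of length two, the middle vertex of the
  \<open>k\<close>-th path being \<open>node i k\<close> with \<open>k \<ge> 1\<close>.
\<close>

definition half_arcs :: "nat \<Rightarrow> (nat \<Rightarrow> nat) \<Rightarrow> (nat \<times> nat) set" where
  "half_arcs n e = (\<Union>i\<in>{1..n}. \<Union>k\<in>{1..e i}. {(0, node i k), (node i k, node i 0)})"

text \<open>An arc is its own pair of endpoints, which rules out parallel arcs; adding the converse
  relation supplies the reversed arcs.\<close>

definition banana_wedge :: "nat \<Rightarrow> (nat \<Rightarrow> nat) \<Rightarrow> (nat, nat \<times> nat) pre_digraph" where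
  "banana_wedge n e = \<lparr>verts = insert 0 {node i k | i k. i \<in> {1..n} \<and> k \<le> e i},
     arcs = half_arcs n e \<union> (half_arcs n e)\<inverse>, tail = fst, head = snd\<rparr>"

lemma verts_banana_wedge:
  "verts (banana_wedge n e) = insert 0 ((\<lambda>(i, k). node i k) ` (SIGMA i:{1..n}. {0..e i}))"
  by (auto simp: banana_wedge_def)

lemma graph_banana_wedge: "graph (banana_wedge n e)"
proof -
  interpret wf_digraph "banana_wedge n e"
    by unfold_locales (auto simp: banana_wedge_def half_arcs_def)
  have "finite (half_arcs n e)" by (simp add: half_arcs_def)
  then have "finite (arcs (banana_wedge n e))" by (simp add: banana_wedge_def)
  moreover have "finite (verts (banana_wedge n e))" by (simp add: verts_banana_wedge)
  ultimately interpret digraph "banana_wedge n e"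
    by unfold_locales (auto simp: banana_wedge_def half_arcs_def arc_to_ends_def)
  have "arcs_ends (banana_wedge n e) = half_arcs n e \<union> (half_arcs n e)\<inverse>"
    by (simp add: arcs_ends_conv banana_wedge_def)
  then show ?thesis
    by (intro graphI) (simp add: symmetric_def sym_Un_converse)
qed

text \<open>Middle vertices are adjacent to 0, and the far end \<open>node i 0\<close> is reached
  along the first path, which exists because \<open>1 \<le> e i\<close>. Symmetry of the arcs then
  connects any two vertices through 0.\<close>

lemma simple_graph_banana_wedge:
  assumes "1 \<le> n" "\<And>i. 1 \<le> i \<Longrightarrow> i \<le> n \<Longrightarrow> 1 \<le> e i"
  shows "simple_graph (banana_wedge n e)"
proof -
  let ?G = "banana_wedge n e"
  interpret graph ?G by (rule graph_banana_wedge)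
  have adj: "(a, b) \<in> arcs_ends ?G" if "(a, b) \<in> half_arcs n e" for a b
    using that by (force simp: arcs_ends_conv banana_wedge_def)
  have from0: "0 \<rightarrow>\<^sup>*\<^bsub>?G\<^esub> x" if x_in: "x \<in> verts ?G" for x
  proof (cases "x = 0")
    case True
    then show ?thesis using x_in by simp
  next
    case False
    then obtain i k where x: "x = node i k" "1 \<le> i" "i \<le> n" "k \<le> e i"
      using x_in by (auto simp: banana_wedge_def)
    have mid: "0 \<rightarrow>\<^bsub>?G\<^esub> node i l" if "1 \<le> l" "l \<le> e i" for l
      by (rule adj) (use that x in \<open>auto simp: half_arcs_def\<close>)
    have "node i 1 \<rightarrow>\<^bsub>?G\<^esub> node i 0"
      by (rule adj) (use x assms(2) in \<open>force simp: half_arcs_def\<close>)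
    then have "0 \<rightarrow>\<^sup>*\<^bsub>?G\<^esub> node i 0"
      using mid[of 1] assms(2) x by (meson order_refl reachable_adjI reachable_adj_trans)
    then show ?thesis using mid[of k] x by (cases "k = 0") auto
  qed
  have "u \<rightarrow>\<^sup>*\<^bsub>?G\<^esub> v" if "u \<in> verts ?G" "v \<in> verts ?G" for u v
    using from0 that symmetric_reachable[OF sym_arcs] reachable_trans by blast
  then have conn: "connected ?G"
    unfolding connected_def
    by (intro strongly_connectedI)
      (simp_all add: reachable_mk_symmetricI verts_banana_wedge)
  have "{0, node 1 0} \<subseteq> verts ?G"
    using assms(1) by (force simp: banana_wedge_def)
  then have "card {0, node 1 0} \<le> card (verts ?G)"
    by (intro card_mono) auto
  then have "1 < card (verts ?G)" by simp
  then show ?thesis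
    unfolding simple_graph_iff_graph using conn graph_banana_wedge by blast
qed

section \<open>Degree, Laplacian and linear systems on the wedge\<close>

lemma divisor_degree_banana_wedge:
  "divisor_degree (banana_wedge n e) E = E 0 + (\<Sum>i=1..n. E (node i 0) + (\<Sum>k=1..e i. E (node i k)))"
proof -
  have "sum E ((\<lambda>(i, k). node i k) ` (SIGMA i:{1..n}. {0..e i})) =
      (\<Sum>i=1..n. \<Sum>k=0..e i. E (node i k))"
    by (subst sum.reindex) (auto simp: inj_on_def sum.Sigma split_beta)
  then have "sum E ((\<lambda>(i, k). node i k) ` (SIGMA i:{1..n}. {0..e i})) =
      (\<Sum>i=1..n. E (node i 0) + (\<Sum>k=1..e i. E (node i k)))"
    by (simp add: sum.atLeast_Suc_atMost)
  then show ?thesis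
    unfolding divisor_degree_def verts_banana_wedge by (subst sum.insert) auto
qed

lemma laplacian_banana_wedge:
  "laplacian (banana_wedge n e) f 0 = (\<Sum>i=1..n. \<Sum>k=1..e i. f 0 - f (node i k))"
  "i \<in> {1..n} \<Longrightarrow>
    laplacian (banana_wedge n e) f (node i 0) = (\<Sum>k=1..e i. f (node i 0) - f (node i k))"
  "i \<in> {1..n} \<Longrightarrow> k \<in> {1..e i} \<Longrightarrow>
    laplacian (banana_wedge n e) f (node i k) = 2 * f (node i k) - f 0 - f (node i 0)"
proof -
  have "out_arcs (banana_wedge n e) 0 = (\<lambda>(i, k). (0, node i k)) ` (SIGMA i:{1..n}. {1..e i})"
    by (auto simp: out_arcs_def banana_wedge_def half_arcs_def image_iff)
  then show "laplacian (banana_wedge n e) f 0 = (\<Sum>i=1..n. \<Sum>k=1..e i. f 0 - f (node i k))"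
    by (simp add: laplacian_def sum.reindex inj_on_def sum.Sigma banana_wedge_def split_beta)
next
  assume i: "i \<in> {1..n}"
  then have "out_arcs (banana_wedge n e) (node i 0) = (\<lambda>k. (node i 0, node i k)) ` {1..e i}"
    by (auto simp: out_arcs_def banana_wedge_def half_arcs_def image_iff)
  then show "laplacian (banana_wedge n e) f (node i 0) = (\<Sum>k=1..e i. f (node i 0) - f (node i k))"
    by (simp add: laplacian_def sum.reindex inj_on_def banana_wedge_def)
next
  assume "i \<in> {1..n}" "k \<in> {1..e i}"
  then have "out_arcs (banana_wedge n e) (node i k) = {(node i k, 0), (node i k, node i 0)}"
    by (auto simp: out_arcs_def banana_wedge_def half_arcs_def image_iff)
  then show "laplacian (banana_wedge n e) f (node i k) = 2 * f (node i k) - f 0 - f (node i 0)"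
    by (simp add: laplacian_def banana_wedge_def)
qed

text \<open>Constants do not affect the Laplacian, so \<open>f\<close> may be taken to vanish at 0;
  \<open>v i\<close> and \<open>w i k\<close> are then its values at the far ends and the middle
  vertices. After this normalisation the bananas interact only through the total outflow from 0,
  which \<open>D 0\<close> must cover.\<close>

lemma linear_system_banana_wedge_iff:
  assumes "divisor_on (banana_wedge n e) D"
  shows "linear_system (banana_wedge n e) D \<noteq> {} \<longleftrightarrow>
    (\<exists>v w. (\<Sum>i=1..n. \<Sum>k=1..e i. w i k) \<le> D 0 \<and>
      (\<forall>i\<in>{1..n}. (\<Sum>k=1..e i. w i k) \<le> int (e i) * v i + D (node i 0) \<and>
        (\<forall>k\<in>{1..e i}. v i \<le> 2 * w i k + D (node i k))))" (is "_ \<longleftrightarrow> ?R")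
proof -
  let ?G = "banana_wedge n e"
  interpret graph ?G by (rule graph_banana_wedge)
  have verts: "(\<forall>Q\<in>verts ?G. X Q) \<longleftrightarrow>
      X 0 \<and> (\<forall>i\<in>{1..n}. X (node i 0) \<and> (\<forall>k\<in>{1..e i}. X (node i k)))" (is "_ \<longleftrightarrow> ?Y") for X
  proof
    assume "\<forall>Q\<in>verts ?G. X Q"
    then show ?Y by (auto simp: verts_banana_wedge)
  next
    assume Y: ?Y
    have "X (node i k)" if "i \<in> {1..n}" "k \<le> e i" for i k
      using Y that by (cases "k = 0") auto
    then show "\<forall>Q\<in>verts ?G. X Q" using Y by (auto simp: verts_banana_wedge)
  qed
  have "linear_system ?G D \<noteq> {} \<longleftrightarrow> (\<exists>f. \<forall>Q\<in>verts ?G. 0 \<le> D Q + laplacian ?G f Q)"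
    using linear_system_nonempty_iff[OF wf_digraph assms] .
  also have "\<dots> \<longleftrightarrow> ?R"
  proof
    assume "\<exists>f. \<forall>Q\<in>verts ?G. 0 \<le> D Q + laplacian ?G f Q"
    then obtain f where f: "\<forall>Q\<in>verts ?G. 0 \<le> D Q + laplacian ?G f Q" by blast
    let ?v = "\<lambda>i. f (node i 0) - f 0" and ?w = "\<lambda>i k. f (node i k) - f 0"
    have "(\<Sum>i=1..n. \<Sum>k=1..e i. ?w i k) \<le> D 0"
    proof -
      have "(\<Sum>i=1..n. \<Sum>k=1..e i. ?w i k) = - (\<Sum>i=1..n. \<Sum>k=1..e i. f 0 - f (node i k))"
        unfolding sum_negf[symmetric] by simp
      also have "\<dots> = - laplacian ?G f 0"
        by (simp only: laplacian_banana_wedge)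
      finally show ?thesis using f unfolding verts by linarith
    qed
    moreover have "(\<Sum>k=1..e i. ?w i k) \<le> int (e i) * ?v i + D (node i 0)"
      if "i \<in> {1..n}" for i
    proof -
      have "0 \<le> D (node i 0) + laplacian ?G f (node i 0)" using f that unfolding verts by blast
      then show ?thesis
        unfolding laplacian_banana_wedge(2)[OF that] by (simp add: sum_subtractf algebra_simps)
    qed
    moreover have "?v i \<le> 2 * ?w i k + D (node i k)" if "i \<in> {1..n}" "k \<in> {1..e i}" for i k
    proof -
      have "0 \<le> D (node i k) + laplacian ?G f (node i k)" using f that unfolding verts by blast
      then show ?thesis unfolding laplacian_banana_wedge(3)[where e = e, OF that] by simp
    qed
    ultimately show ?R by (intro exI[of _ ?v] exI[of _ ?w]) blast
  next
    assume ?R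
    then obtain v w where R: "(\<Sum>i=1..n. \<Sum>k=1..e i. w i k) \<le> D 0"
      "\<And>i. i \<in> {1..n} \<Longrightarrow> (\<Sum>k=1..e i. w i k) \<le> int (e i) * v i + D (node i 0)"
      "\<And>i k. i \<in> {1..n} \<Longrightarrow> k \<in> {1..e i} \<Longrightarrow> v i \<le> 2 * w i k + D (node i k)"
      by blast
    \<comment> \<open>Decoding the vertex number turns \<open>v\<close> and \<open>w\<close> back
      into one function, with value 0 at the wedge point.\<close>
    define f where "f x = (case x of 0 \<Rightarrow> 0
      | Suc y \<Rightarrow> (case prod_decode y of (i, k) \<Rightarrow> if k = 0 then v i else w i k))" for x
    have f: "f 0 = 0" "\<And>i. f (node i 0) = v i" "\<And>i k. 1 \<le> k \<Longrightarrow> f (node i k) = w i k"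
      by (simp_all add: f_def node_def)
    have "0 \<le> D 0 + laplacian ?G f 0"
      using R(1) by (simp add: laplacian_banana_wedge f sum_negf)
    moreover have "0 \<le> D (node i 0) + laplacian ?G f (node i 0)" if "i \<in> {1..n}" for i
      unfolding laplacian_banana_wedge(2)[OF that]
      using R(2)[OF that] by (simp add: f sum_subtractf)
    moreover have "0 \<le> D (node i k) + laplacian ?G f (node i k)"
      if "i \<in> {1..n}" "k \<in> {1..e i}" for i k
      unfolding laplacian_banana_wedge(3)[where e = e, OF that]
      using R(3)[OF that] that by (simp add: f)
    ultimately show "\<exists>f. \<forall>Q\<in>verts ?G. 0 \<le> D Q + laplacian ?G f Q"
      unfolding verts by blast
  qed
  finally show ?thesis .
qed

section \<open>The cost of chips on a single banana\<close>

text \<open>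
  With \<open>w k = \<lceil>(v + b k) / 2\<rceil>\<close>, the outflow \<open>sum w K\<close> for \<open>v\<close> exceeds \<open>sum b K\<close> by exactly
  \<open>card K\<close> more than what the vertex with demand \<open>a\<close> receives for \<open>v - 1\<close>, which is at most \<open>a - 1\<close>
  if \<open>v\<close> is the least sufficient value.
\<close>

lemma banana_firing_exists:
  fixes a :: int and b :: "nat \<Rightarrow> int"
  assumes K: "finite K" "K \<noteq> {}" and a: "0 \<le> a" and b: "\<And>k. k \<in> K \<Longrightarrow> 0 \<le> b k"
  shows "\<exists>v w. (\<forall>k\<in>K. v + b k \<le> 2 * w k) \<and> a + sum w K \<le> int (card K) * v \<and>
    sum w K \<le> (if a + sum b K = 0 then 0 else a + sum b K + int (card K) - 1)"
proof (cases "a + sum b K = 0")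
  case True
  moreover have "0 \<le> sum b K" using b by (simp add: sum_nonneg)
  ultimately have "a = 0" "sum b K = 0" using a by auto
  then have "\<forall>k\<in>K. b k = 0" using b K by (simp add: sum_nonneg_eq_0_iff)
  then show ?thesis using \<open>a = 0\<close> True by (intro exI[of _ 0] exI[of _ "\<lambda>_. 0"]) auto
next
  case False
  \<comment> \<open>With value \<open>t\<close> at the far end and the least admissible values at
    the middle vertices, the far end receives \<open>\<phi> t\<close> chips.\<close>
  define \<phi> where "\<phi> t = (\<Sum>k\<in>K. (int t - b k) div 2)" for t :: nat
  have phi0: "\<phi> 0 < a"
  proof (rule ccontr)
    assume "\<not> \<phi> 0 < a"
    moreover have "- b k div 2 \<le> 0" if "k \<in> K" for k using b[OF that] by linarith
    then have "\<phi> 0 \<le> 0" unfolding \<phi>_def by (simp add: sum_nonpos)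
    ultimately have "a = 0" "\<phi> 0 = 0" using a by auto
    then have "(\<Sum>k\<in>K. - (- b k div 2)) = 0" by (simp add: \<phi>_def sum_negf)
    moreover have "0 \<le> - (- b k div 2)" if "k \<in> K" for k using b[OF that] by linarith
    ultimately have z: "\<forall>k\<in>K. - (- b k div 2) = 0"
      using K(1) by (subst (asm) sum_nonneg_eq_0_iff) auto
    have "b k = 0" if "k \<in> K" for k
      using z b[OF that] that by fastforce
    then show False using False \<open>a = 0\<close> by simp
  qed
  \<comment> \<open>For this value the path through \<open>k0\<close> alone already delivers
    \<open>a\<close> chips, and no other path takes any away.\<close>
  have "a \<le> \<phi> (nat (2 * a + sum b K))"
  proof -
    obtain k0 where k0: "k0 \<in> K" using K by blast
    let ?t = "2 * a + sum b K"
    have le: "b k \<le> sum b K" if "k \<in> K" for k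
      using K(1) b that by (intro member_le_sum) auto
    have t: "int (nat ?t) = ?t" using a b by (simp add: sum_nonneg)
    have "a \<le> (?t - b k0) div 2" using le[OF k0] by linarith
    also have "\<dots> \<le> (\<Sum>k\<in>K. (?t - b k) div 2)"
    proof (intro member_le_sum)
      fix k assume "k \<in> K - {k0}"
      then show "0 \<le> (?t - b k) div 2" using le[of k] a by auto
    qed (use K k0 in auto)
    finally show ?thesis unfolding \<phi>_def t .
  qed
  then obtain t where t: "\<phi> t < a" "a \<le> \<phi> (Suc t)"
    using ex_least_nat_less[of "\<lambda>t. a \<le> \<phi> t"] phi0 by (meson not_le order_refl)
  \<comment> \<open>This is the ceiling of \<open>(v + b k) / 2\<close> at
    \<open>v = int t + 1\<close>, written so that both \<open>\<phi> t\<close> and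
    \<open>\<phi> (Suc t)\<close> can be read off.\<close>
  define w where "w k = b k + (int t + 2 - b k) div 2" for k
  have "\<phi> (Suc t) = int (card K) * (int t + 1) - sum w K"
  proof -
    have "\<phi> (Suc t) = (\<Sum>k\<in>K. int t + 1 - w k)"
      unfolding \<phi>_def w_def by (intro sum.cong refl) linarith
    then show ?thesis by (simp add: sum_subtractf)
  qed
  moreover have "sum w K = sum b K + \<phi> t + int (card K)"
  proof -
    have "sum w K = (\<Sum>k\<in>K. b k + (int t - b k) div 2 + 1)"
      unfolding w_def by (intro sum.cong refl) linarith
    then show ?thesis by (simp add: sum.distrib \<phi>_def)
  qed
  moreover have "int t + 1 + b k \<le> 2 * w k" for k
  proof -
    have "x \<le> 2 * ((x + 1) div 2)" for x :: int by presburger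
    from this[of "int t + 1 - b k"] show ?thesis unfolding w_def by simp
  qed
  ultimately show ?thesis
    using t False by (intro exI[of _ "int t + 1"] exI[of _ w]) auto
qed

text \<open>Summing the middle inequalities and comparing with the far end gives
  \<open>c \<le> sum w K\<close>. If \<open>c > 0\<close>, this forces \<open>v > 0\<close>, and
  integrality gives \<open>1 \<le> w k\<close> on every path: even one chip at the far end costs a
  chip per path.\<close>

lemma banana_firing_bound:
  fixes v :: int and w :: "nat \<Rightarrow> int"
  assumes "K \<noteq> {}" "finite K" and w: "\<And>k. k \<in> K \<Longrightarrow> v \<le> 2 * w k"
    and v: "sum w K + c \<le> int (card K) * v" and c: "0 \<le> c"
  shows "(if c = 0 then 0 else int (card K)) \<le> sum w K"
proof -
  have "int (card K) * v = (\<Sum>k\<in>K. v)" by simp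
  also have "\<dots> \<le> (\<Sum>k\<in>K. 2 * w k)" by (intro sum_mono w)
  also have "\<dots> = 2 * sum w K" by (simp add: sum_distrib_left)
  finally have S: "c \<le> sum w K" using v by linarith
  show ?thesis
  proof (cases "c = 0")
    case True
    then show ?thesis using S by simp
  next
    case False
    then have "0 < int (card K) * v" using S v c by linarith
    then have "0 < v" by (simp add: zero_less_mult_iff)
    then have "1 \<le> w k" if "k \<in> K" for k using w[OF that] by linarith
    then have "(\<Sum>k\<in>K. 1) \<le> sum w K" by (intro sum_mono)
    then show ?thesis using False by simp
  qed
qed

text \<open>The largest element of a subset of \<open>{1..n}\<close> is at least the size of the
  subset, so removing maxima one at a time compares each term with an earlier, hence no smaller,
  value of \<open>g\<close>.\<close>

lemma sum_le_sum_initial: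
  fixes g :: "nat \<Rightarrow> 'a :: ordered_comm_monoid_add"
  assumes "finite I" "I \<subseteq> {1..n}"
    and "\<And>i j. 1 \<le> i \<Longrightarrow> i \<le> j \<Longrightarrow> j \<le> n \<Longrightarrow> g j \<le> g i"
  shows "sum g I \<le> sum g {1..card I}"
  using assms(1,2)
proof (induction I rule: finite_linorder_max_induct)
  case empty
  then show ?case by simp
next
  case (insert b A)
  then have "insert b A \<subseteq> {1..b}" by (auto simp: less_imp_le)
  then have "card (insert b A) \<le> b" using card_mono[of "{1..b}"] by fastforce
  moreover have "b \<notin> A" using insert by blast
  ultimately have "Suc (card A) \<le> b" using insert by simp
  then have "g b \<le> g (Suc (card A))" using insert assms(3) by simp
  moreover have "sum g A \<le> sum g {1..card A}" using insert by simp
  ultimately show ?case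
    using insert \<open>b \<notin> A\<close> by (simp add: add.commute add_mono)
qed

section \<open>Rank jumps of the wedge at P\<close>

text \<open>Truncated subtraction lets one formula serve both \<open>j \<le> n\<close> and
  \<open>j > n\<close>. The threshold equals \<open>j\<close> plus the sum of \<open>e i - 1\<close>
  over the first \<open>min j n\<close> bananas, which is the shape of the upper bound.\<close>

lemma rank_jump_set_banana_wedge:
  fixes n :: nat and e :: "nat \<Rightarrow> nat"
  assumes pos: "\<And>i. 1 \<le> i \<Longrightarrow> i \<le> n \<Longrightarrow> 1 \<le> e i"
    and dec: "\<And>i j. 1 \<le> i \<Longrightarrow> i \<le> j \<Longrightarrow> j \<le> n \<Longrightarrow> e j \<le> e i"
  shows "rank_jump_set (banana_wedge n e) 0 = range (\<lambda>j. (\<Sum>i=1..min j n. e i) + (j - n))"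
proof (rule rank_jump_set_eq_range)
  let ?G = "banana_wedge n e"
  let ?m = "\<lambda>j. (\<Sum>i=1..min j n. e i) + (j - n)"
  interpret graph ?G by (rule graph_banana_wedge)
  show "strict_mono ?m"
  proof (rule strict_mono_Suc_iff[THEN iffD2], intro allI)
    fix j
    show "?m j < ?m (Suc j)"
    proof (cases "j < n")
      case True
      then have "min (Suc j) n = Suc j" "min j n = j" by auto
      then show ?thesis using True pos[of "Suc j"] by simp
    next
      case False
      then have "min (Suc j) n = n" "min j n = n" by auto
      then show ?thesis using False by simp
    qed
  qed
  show "?m 0 = 0" by simp
  show "finite (verts ?G)" by simp
  fix j :: nat and k :: int
  show "(\<forall>E. effective_on ?G E \<and> divisor_degree ?G E = int j \<longrightarrow>
      linear_system ?G (\<lambda>Q. point_multiple k 0 Q - E Q) \<noteq> {}) \<longleftrightarrow> int (?m j) \<le> k"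
  proof
    assume H: "\<forall>E. effective_on ?G E \<and> divisor_degree ?G E = int j \<longrightarrow>
      linear_system ?G (\<lambda>Q. point_multiple k 0 Q - E Q) \<noteq> {}"
    \<comment> \<open>The extremal divisor: one chip on the far end of each of the first
      \<open>min j n\<close> bananas, and any surplus on 0.\<close>
    define E :: "nat \<Rightarrow> int" where
      "E Q = (if Q = 0 then int (j - n) else if Q \<in> (\<lambda>i. node i 0) ` {1..min j n} then 1 else 0)" for Q
    have E: "E 0 = int (j - n)"
      "\<And>i. i \<in> {1..n} \<Longrightarrow> E (node i 0) = (if i \<le> j then 1 else 0)"
      "\<And>i k. i \<in> {1..n} \<Longrightarrow> 1 \<le> k \<Longrightarrow> E (node i k) = 0"
      by (auto simp: E_def)
    have eff: "effective_on ?G E"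
      by (auto simp: effective_on_def divisor_on_def E_def banana_wedge_def split: if_splits)
    have "divisor_degree ?G E = int (j - n) + (\<Sum>i=1..n. if i \<le> j then 1 else 0)"
      by (simp add: divisor_degree_banana_wedge E)
    also have "(\<Sum>i=1..n. if i \<le> j then 1 else 0) = int (min j n)"
    proof -
      have "{1..n} \<inter> {i. i \<le> j} = {1..min j n}" by auto
      then show ?thesis by (simp add: sum.If_cases)
    qed
    finally have "divisor_degree ?G E = int j" by simp
    with H eff have "linear_system ?G (\<lambda>Q. point_multiple k 0 Q - E Q) \<noteq> {}" by blast
    moreover have "divisor_on ?G (\<lambda>Q. point_multiple k 0 Q - E Q)"
      using eff by (auto simp: effective_on_def divisor_on_def point_multiple_def banana_wedge_def)
    ultimately have "\<exists>v w. (\<Sum>i=1..n. \<Sum>l=1..e i. w i l) \<le> k - E 0 \<and>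
        (\<forall>i\<in>{1..n}. (\<Sum>l=1..e i. w i l) \<le> int (e i) * v i - E (node i 0) \<and>
          (\<forall>l\<in>{1..e i}. v i \<le> 2 * w i l - E (node i l)))"
      by (subst (asm) linear_system_banana_wedge_iff) (simp_all add: point_multiple_def)
    then obtain v w where "(\<Sum>i=1..n. \<Sum>l=1..e i. w i l) \<le> k - E 0 \<and>
        (\<forall>i\<in>{1..n}. (\<Sum>l=1..e i. w i l) \<le> int (e i) * v i - E (node i 0) \<and>
          (\<forall>l\<in>{1..e i}. v i \<le> 2 * w i l - E (node i l)))"
      by (elim exE)
    then have vw: "(\<Sum>i=1..n. \<Sum>l=1..e i. w i l) \<le> k - E 0"
      "\<And>i. i \<in> {1..n} \<Longrightarrow> (\<Sum>l=1..e i. w i l) \<le> int (e i) * v i - E (node i 0)"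
      "\<And>i l. i \<in> {1..n} \<Longrightarrow> l \<in> {1..e i} \<Longrightarrow> v i \<le> 2 * w i l - E (node i l)"
      by simp_all
    have "(if i \<le> j then int (e i) else 0) \<le> (\<Sum>l=1..e i. w i l)" if i: "i \<in> {1..n}" for i
      using banana_firing_bound[of "{1..e i}" "v i" "w i" "E (node i 0)"] vw(2)[OF i] vw(3)[OF i] pos i
      by (auto simp: E split: if_splits)
    then have "(\<Sum>i=1..n. if i \<le> j then int (e i) else 0) \<le> (\<Sum>i=1..n. \<Sum>l=1..e i. w i l)"
      by (intro sum_mono)
    moreover have "(\<Sum>i=1..n. if i \<le> j then int (e i) else 0) = (\<Sum>i=1..min j n. int (e i))"
    proof -
      have "{1..n} \<inter> {i. i \<le> j} = {1..min j n}" by auto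
      then show ?thesis by (simp add: sum.If_cases)
    qed
    ultimately show "int (?m j) \<le> k" using vw(1) by (simp add: E(1))
  next
    assume k: "int (?m j) \<le> k"
    show "\<forall>E. effective_on ?G E \<and> divisor_degree ?G E = int j \<longrightarrow>
      linear_system ?G (\<lambda>Q. point_multiple k 0 Q - E Q) \<noteq> {}"
    proof (intro allI impI)
      fix E assume EE: "effective_on ?G E \<and> divisor_degree ?G E = int j"
      have E0: "0 \<le> E 0" and Epos: "\<And>i l. i \<in> {1..n} \<Longrightarrow> l \<le> e i \<Longrightarrow> 0 \<le> E (node i l)"
        using EE by (auto simp: effective_on_def banana_wedge_def)
      define d where "d i = E (node i 0) + (\<Sum>l=1..e i. E (node i l))" for i
      have d0: "0 \<le> d i" if "i \<in> {1..n}" for i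
        unfolding d_def using Epos that by (intro add_nonneg_nonneg sum_nonneg) auto
      have deg: "E 0 + (\<Sum>i=1..n. d i) = int j"
        using EE by (simp add: divisor_degree_banana_wedge d_def)
      have "\<forall>i\<in>{1..n}. \<exists>v w. (\<forall>l\<in>{1..e i}. v + E (node i l) \<le> 2 * w l) \<and>
          E (node i 0) + (\<Sum>l=1..e i. w l) \<le> int (e i) * v \<and>
          (\<Sum>l=1..e i. w l) \<le> (if d i = 0 then 0 else d i + int (e i) - 1)"
      proof
        fix i assume i: "i \<in> {1..n}"
        then have "{1..e i} \<noteq> {}" using pos by simp
        moreover have "card {1..e i} = e i" by simp
        ultimately show "\<exists>v w. (\<forall>l\<in>{1..e i}. v + E (node i l) \<le> 2 * w l) \<and>
          E (node i 0) + (\<Sum>l=1..e i. w l) \<le> int (e i) * v \<and>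
          (\<Sum>l=1..e i. w l) \<le> (if d i = 0 then 0 else d i + int (e i) - 1)"
          using banana_firing_exists[of "{1..e i}" "E (node i 0)" "\<lambda>l. E (node i l)"] Epos i
          unfolding d_def by (metis atLeastAtMost_iff finite_atLeastAtMost le0)
      qed
      \<comment> \<open>The firings of the separate bananas combine freely, as all of them take the
        value 0 at the wedge point.\<close>
      then obtain v w where "\<forall>i\<in>{1..n}. (\<forall>l\<in>{1..e i}. v i + E (node i l) \<le> 2 * w i l) \<and>
          E (node i 0) + (\<Sum>l=1..e i. w i l) \<le> int (e i) * v i \<and>
          (\<Sum>l=1..e i. w i l) \<le> (if d i = 0 then 0 else d i + int (e i) - 1)"
        unfolding bchoice_iff by (elim exE)
      then have vw:
        "\<And>i l. i \<in> {1..n} \<Longrightarrow> l \<in> {1..e i} \<Longrightarrow> v i + E (node i l) \<le> 2 * w i l"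
        "\<And>i. i \<in> {1..n} \<Longrightarrow> E (node i 0) + (\<Sum>l=1..e i. w i l) \<le> int (e i) * v i"
        "\<And>i. i \<in> {1..n} \<Longrightarrow> (\<Sum>l=1..e i. w i l) \<le> (if d i = 0 then 0 else d i + int (e i) - 1)"
        by blast+
      \<comment> \<open>Only bananas that carry chips incur the extra cost \<open>e i - 1\<close>;
        each carries at least one, so there are at most \<open>min j n\<close> of them.\<close>
      define I where "I = {i \<in> {1..n}. d i \<noteq> 0}"
      have I: "finite I" "I \<subseteq> {1..n}" by (auto simp: I_def)
      have "int (card I) = (\<Sum>i\<in>I. 1)" by simp
      also have "\<dots> \<le> (\<Sum>i\<in>I. d i)"
        using d0 by (intro sum_mono) (force simp: I_def)
      also have "\<dots> \<le> (\<Sum>i=1..n. d i)"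
        using I d0 by (intro sum_mono2) auto
      finally have "int (card I) \<le> int j" using deg E0 by linarith
      moreover have "card I \<le> n" using card_mono[OF _ I(2)] by simp
      ultimately have cI: "card I \<le> min j n" by simp
      have "(\<Sum>i=1..n. \<Sum>l=1..e i. w i l) \<le> (\<Sum>i=1..n. if d i = 0 then 0 else d i + int (e i) - 1)"
        by (intro sum_mono vw)
      also have "\<dots> = (\<Sum>i=1..n. d i + (if i \<in> I then int (e i) - 1 else 0))"
        by (intro sum.cong) (auto simp: I_def)
      also have "\<dots> = (\<Sum>i=1..n. d i) + (\<Sum>i\<in>I. int (e i) - 1)"
        using I(2) by (simp add: sum.distrib sum.If_cases Int_absorb1)
      also have "(\<Sum>i\<in>I. int (e i) - 1) \<le> (\<Sum>i=1..card I. int (e i) - 1)"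
        by (intro sum_le_sum_initial[of _ n] I diff_right_mono of_nat_mono dec)
      \<comment> \<open>Passing from \<open>card I\<close> to \<open>min j n\<close> terms only adds
        nonnegative ones because \<open>1 \<le> e i\<close>.\<close>
      also have "\<dots> \<le> (\<Sum>i=1..min j n. int (e i) - 1)"
      proof (rule sum_mono2)
        fix i assume "i \<in> {1..min j n} - {1..card I}"
        then have "1 \<le> e i" by (intro pos) auto
        then show "0 \<le> int (e i) - 1" by simp
      qed (use cI in auto)
      also have "\<dots> = int (?m j) - int j"
        by (simp add: sum_subtractf)
      finally have "(\<Sum>i=1..n. \<Sum>l=1..e i. w i l) \<le> k - E 0"
        using k deg by linarith
      moreover have "(\<Sum>l=1..e i. w i l) \<le> int (e i) * v i - E (node i 0)" if "i \<in> {1..n}" for i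
        using vw(2)[OF that] by linarith
      moreover have "v i \<le> 2 * w i l - E (node i l)" if "i \<in> {1..n}" "l \<in> {1..e i}" for i l
        using vw(1)[OF that] by linarith
      moreover have "divisor_on ?G (\<lambda>Q. point_multiple k 0 Q - E Q)"
        using EE by (auto simp: effective_on_def divisor_on_def point_multiple_def banana_wedge_def)
      ultimately show "linear_system ?G (\<lambda>Q. point_multiple k 0 Q - E Q) \<noteq> {}"
        by (subst linear_system_banana_wedge_iff)
          (simp_all add: point_multiple_def, intro exI[of _ v] exI[of _ w], simp)
    qed
  qed
qed

section \<open>Dropping the vanishing \<open>e i\<close>\<close>

text \<open>Beyond \<open>N\<close> the partial sums stay at \<open>s N\<close>, so they contribute
  only the starting point of the final ray \<open>s n + m\<close>.\<close>

lemma range_sum_initial_eq: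
  fixes e :: "nat \<Rightarrow> nat"
  assumes "N \<le> n" "\<And>i. N < i \<Longrightarrow> i \<le> n \<Longrightarrow> e i = 0"
  defines "s \<equiv> \<lambda>i. \<Sum>j=1..i. e j"
  shows "range (\<lambda>j. (\<Sum>i=1..min j N. e i) + (j - N)) =
    {0} \<union> {s i | i. 1 \<le> i \<and> i \<le> n - 1} \<union> {s n + m | m. True}" (is "?L = ?R")
proof -
  have sN: "s i = s N" if "N \<le> i" "i \<le> n" for i
    unfolding s_def using that assms(2) by (intro sum.mono_neutral_right) auto
  have m: "(\<Sum>i=1..min j N. e i) + (j - N) = s (min j N) + (j - N)" for j
    by (simp add: s_def)
  show ?thesis
    unfolding m
  proof (intro equalityI subsetI)
    fix x assume "x \<in> range (\<lambda>j. s (min j N) + (j - N))"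
    then obtain j where x: "x = s (min j N) + (j - N)" by blast
    show "x \<in> ?R"
    proof (cases "j < N")
      case True
      show ?thesis
      proof (cases "j = 0")
        case True
        then show ?thesis using x by (simp add: s_def)
      next
        case False
        then have "x = s j \<and> 1 \<le> j \<and> j \<le> n - 1" using x \<open>j < N\<close> assms(1) by auto
        then show ?thesis by blast
      qed
    next
      case False
      then have "x = s n + (j - N)" using x sN[of n] assms(1) by simp
      then show ?thesis by blast
    qed
  next
    fix x assume "x \<in> ?R"
    then consider "x = 0" | i where "x = s i" "i < n" | m where "x = s n + m"
      by fastforce
    then show "x \<in> range (\<lambda>j. s (min j N) + (j - N))"
    proof cases
      case 1
      then have "x = s (min 0 N) + (0 - N)" by (simp add: s_def)
      then show ?thesis by blast
    next
      case 2
      have "x = s (min (min i N) N) + (min i N - N)"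
        using 2 sN[of i] by (cases "i \<le> N") auto
      then show ?thesis by blast
    next
      case 3
      then have "x = s (min (N + m) N) + (N + m - N)" using sN[of n] assms(1) by simp
      then show ?thesis by blast
    qed
  qed
qed

theorem theoremC:
  fixes n :: nat and e :: "nat \<Rightarrow> nat"
  assumes "n \<ge> 1"
    and "\<And>i j. 1 \<le> i \<Longrightarrow> i \<le> j \<Longrightarrow> j \<le> n \<Longrightarrow> e i \<ge> e j"
  shows "let s = (\<lambda>i. \<Sum>j=1..i. e j) in
    \<exists>(G :: (nat, nat \<times> nat) pre_digraph) P. simple_graph G \<and> P \<in> verts G \<and>
      rank_jump_set G P = {0} \<union> {s i | i. 1 \<le> i \<and> i \<le> n - 1} \<union> {s n + m | m. True}"
proof -
  \<comment> \<open>By monotonicity the positive \<open>e i\<close> form an initial segment, and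
    \<open>N\<close> is its length.\<close>
  have "\<exists>N\<le>n. \<forall>i\<in>{1..n}. 1 \<le> e i \<longleftrightarrow> i \<le> N"
  proof (cases "{i \<in> {1..n}. 1 \<le> e i} = {}")
    case True
    then show ?thesis by (intro exI[of _ 0]) auto
  next
    case False
    let ?M = "Max {i \<in> {1..n}. 1 \<le> e i}"
    have M: "?M \<in> {i \<in> {1..n}. 1 \<le> e i}" using False by (intro Max_in) auto
    have "1 \<le> e i \<longleftrightarrow> i \<le> ?M" if i: "i \<in> {1..n}" for i
    proof
      assume "1 \<le> e i"
      then show "i \<le> ?M" using i by (intro Max_ge) auto
    next
      assume "i \<le> ?M"
      moreover have "1 \<le> e ?M" "?M \<le> n" using M by auto
      ultimately show "1 \<le> e i" using assms(2)[of i ?M] i by simp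
    qed
    then show ?thesis using M by (intro exI[of _ ?M]) simp
  qed
  then obtain N where N: "N \<le> n" "\<And>i. i \<in> {1..n} \<Longrightarrow> 1 \<le> e i \<longleftrightarrow> i \<le> N" by metis
  have pos: "1 \<le> e i" if "1 \<le> i" "i \<le> N" for i
    using N(1) N(2)[of i] that by simp
  have zero: "e i = 0" if "N < i" "i \<le> n" for i
    using N(2)[of i] that by simp
  define s where "s = (\<lambda>i. \<Sum>j=1..i. e j)"
  have target: "range (\<lambda>j. (\<Sum>i=1..min j N. e i) + (j - N)) =
      {0} \<union> {s i | i. 1 \<le> i \<and> i \<le> n - 1} \<union> {s n + m | m. True}"
    unfolding s_def by (rule range_sum_initial_eq[OF N(1) zero])
  have "\<exists>n' e'. simple_graph (banana_wedge n' e') \<and>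
      rank_jump_set (banana_wedge n' e') 0 = range (\<lambda>j. (\<Sum>i=1..min j N. e i) + (j - N))"
  proof (cases "N = 0")
    case True
    \<comment> \<open>With no bananas the wedge would be a single vertex, which is not a simple
      graph. The path with two edges replaces it: its thresholds are \<open>j\<close> itself, so
      every natural number is a jump.\<close>
    have "rank_jump_set (banana_wedge 1 (\<lambda>_. 1)) 0 =
        range (\<lambda>j. (\<Sum>i=1..min j 1. 1) + (j - 1))"
      by (rule rank_jump_set_banana_wedge) auto
    also have "(\<lambda>j. (\<Sum>i=1..min j 1. 1) + (j - 1)) = (\<lambda>j::nat. j)"
      by (auto simp: min_def)
    finally have "rank_jump_set (banana_wedge 1 (\<lambda>_. 1)) 0 = range (\<lambda>j. j)" .
    moreover have "simple_graph (banana_wedge 1 (\<lambda>_. 1))"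
      by (rule simple_graph_banana_wedge) auto
    ultimately show ?thesis using True by (intro exI[of _ 1] exI[of _ "\<lambda>_. 1"]) simp
  next
    case False
    have "simple_graph (banana_wedge N e)"
      using False pos by (intro simple_graph_banana_wedge) auto
    moreover have "rank_jump_set (banana_wedge N e) 0 =
        range (\<lambda>j. (\<Sum>i=1..min j N. e i) + (j - N))"
      using pos assms(2) N(1) by (intro rank_jump_set_banana_wedge) auto
    ultimately show ?thesis by blast
  qed
  moreover have "0 \<in> verts (banana_wedge n' e')" for n' e'
    by (simp add: banana_wedge_def)
  ultimately show ?thesis
    unfolding Let_def s_def[symmetric] target by (metis (no_types, lifting))
qed

end
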